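(* Let $\mathcal G$ be the first Grigorchuk group with its branch action on the $2$-regular rooted tree $T$. For any finite subset $C$ of $\partial T$, we have \[ \overline{\operatorname{Stab}_{\mathcal G}(C)}=\operatorname{Stab}_{\overline{\mathcal G}}(C). \] If moreover $C$ is contained in one $\mathcal G$-orbit, then we also have \[ \overline{\operatorname{SStab}_{\mathcal G}(C)}=\operatorname{SStab}_{\overline{\mathcal G}}(C). \]
   Context: $T$ is the $2$-regular rooted tree (finite words over $\{0,1\}$), $\partial T$ its boundary (infinite words), and $\operatorname{Aut}(T)$ the group of automorphisms fixing the root. $\operatorname{Aut}(T)$ carries its profinite topology, in which the pointwise stabilizers of the levels form a basis of neighbourhoods of $1$; $\overline{H}$ denotes the closure of $H\le\operatorname{Aut}(T)$ in $\operatorname{Aut}(T)$. For an automorphism $g$ fixing the first level we write $g=(g_0,g_1)$ if $g(iw)=i\,g_i(w)$. The first Grigorchuk group is $\mathcal G=\langle a,b,c,d\rangle\le\operatorname{Aut}(T)$, where $a(0w)=1w$, $a(1w)=0w$, and $b=(a,c)$, $c=(a,d)$, $d=(1,b)$. For $H\le\operatorname{Aut}(T)$ and $C\subseteq\partial T$, $\operatorname{Stab}_H(C)$ is the pointwise stabilizer and $\operatorname{SStab}_H(C)$ the setwise stabilizer of $C$ in $H$. *)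

theory Defs
  imports
    "HOL-Analysis.Abstract_Topology"
    "HOL-Algebra.Generated_Groups"
    "HOL-Algebra.Group_Action"
begin

text \<open>The vertices of the rooted tree are the finite words \<^typ>\<open>bool list\<close> with root
  \<^term>\<open>[]\<close>; the letters 0 and 1 are \<^term>\<open>False\<close> and \<^term>\<open>True\<close>.\<close>

definition tree_adj :: "bool list \<Rightarrow> bool list \<Rightarrow> bool" where
  "tree_adj u v \<longleftrightarrow> (\<exists>x. v = u @ [x]) \<or> (\<exists>x. u = v @ [x])"

definition tree_automorphism :: "(bool list \<Rightarrow> bool list) \<Rightarrow> bool" where
  "tree_automorphism g \<longleftrightarrow> bij g \<and> g [] = [] \<and> (\<forall>u v. tree_adj (g u) (g v) \<longleftrightarrow> tree_adj u v)"

definition AutT :: "(bool list \<Rightarrow> bool list) monoid" where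
  "AutT = \<lparr>carrier = {g. tree_automorphism g}, mult = (\<circ>), one = id\<rparr>"

definition level_stab :: "nat \<Rightarrow> (bool list \<Rightarrow> bool list) set" where
  "level_stab n = {g \<in> carrier AutT. \<forall>w. length w = n \<longrightarrow> g w = w}"

definition aut_open :: "(bool list \<Rightarrow> bool list) set \<Rightarrow> bool" where
  "aut_open U \<longleftrightarrow>
     U \<subseteq> carrier AutT \<and> (\<forall>g\<in>U. \<exists>n. g <#\<^bsub>AutT\<^esub> level_stab n \<subseteq> U)"

definition aut_topology :: "(bool list \<Rightarrow> bool list) topology" where
  "aut_topology = topology aut_open"

text \<open>An infinite word is a function \<^typ>\<open>nat \<Rightarrow> bool\<close>. The letter in position \<open>n\<close> of the
  image of \<open>\<xi>\<close> is read off from the image of the prefix of \<open>\<xi>\<close> of length \<open>n + 1\<close>; see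
  \<open>boundary_act_prefix\<close> below for the defining property of the action.\<close>

definition boundary_act :: "(bool list \<Rightarrow> bool list) \<Rightarrow> (nat \<Rightarrow> bool) \<Rightarrow> (nat \<Rightarrow> bool)" where
  "boundary_act g \<xi> = (\<lambda>n. g (map \<xi> [0..<Suc n]) ! n)"

definition Stab :: "(bool list \<Rightarrow> bool list) set \<Rightarrow> (nat \<Rightarrow> bool) set \<Rightarrow> (bool list \<Rightarrow> bool list) set"
  where "Stab H C = {h \<in> H. \<forall>\<xi>\<in>C. boundary_act h \<xi> = \<xi>}"

definition SStab :: "(bool list \<Rightarrow> bool list) set \<Rightarrow> (nat \<Rightarrow> bool) set \<Rightarrow> (bool list \<Rightarrow> bool list) set"
  where "SStab H C = {h \<in> H. boundary_act h ` C = C}"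

fun grig_a :: "bool list \<Rightarrow> bool list" where
  "grig_a [] = []"
| "grig_a (x # w) = (\<not> x) # w"

fun grig_b grig_c grig_d :: "bool list \<Rightarrow> bool list" where
  "grig_b [] = []"
| "grig_b (False # w) = False # grig_a w"
| "grig_b (True # w) = True # grig_c w"
| "grig_c [] = []"
| "grig_c (False # w) = False # grig_a w"
| "grig_c (True # w) = True # grig_d w"
| "grig_d [] = []"
| "grig_d (False # w) = False # w"
| "grig_d (True # w) = True # grig_b w"

definition Grigorchuk :: "(bool list \<Rightarrow> bool list) set" where
  "Grigorchuk = generate AutT {grig_a, grig_b, grig_c, grig_d}"


lemma tree_automorphism_snoc:
  assumes "tree_automorphism g"
  shows "\<exists>y. g (w @ [x]) = g w @ [y]"
proof (induction w arbitrary: x rule: rev_induct)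
  case Nil
  have "tree_adj (g []) (g ([] @ [x]))"
    using assms unfolding tree_automorphism_def tree_adj_def by blast
  then show ?case using assms by (auto simp: tree_automorphism_def tree_adj_def)
next
  case (snoc z w)
  then obtain y where y: "g (w @ [z]) = g w @ [y]" by blast
  have "tree_adj (g (w @ [z])) (g ((w @ [z]) @ [x]))"
    using assms unfolding tree_automorphism_def tree_adj_def by blast
  then consider "\<exists>t. g ((w @ [z]) @ [x]) = g (w @ [z]) @ [t]"
    | "\<exists>t. g (w @ [z]) = g ((w @ [z]) @ [x]) @ [t]"
    unfolding tree_adj_def by blast
  then show ?case
  proof cases
    case 2
    then have "g ((w @ [z]) @ [x]) = g w" using y by auto
    then have "(w @ [z]) @ [x] = w"
      using assms by (metis tree_automorphism_def bij_is_inj injD)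
    then show ?thesis by simp
  qed
qed

lemma tree_automorphism_length:
  assumes "tree_automorphism g"
  shows "length (g w) = length w"
proof (induction w rule: rev_induct)
  case Nil
  then show ?case using assms by (simp add: tree_automorphism_def)
next
  case (snoc x w)
  then show ?case using tree_automorphism_snoc[OF assms, of w x] by auto
qed

lemma boundary_act_prefix:
  assumes "tree_automorphism g"
  shows "map (boundary_act g \<xi>) [0..<n] = g (map \<xi> [0..<n])"
proof (induction n)
  case 0
  then show ?case using assms by (simp add: tree_automorphism_def)
next
  case (Suc n)
  obtain y where y: "g (map \<xi> [0..<Suc n]) = g (map \<xi> [0..<n]) @ [y]"
    using tree_automorphism_snoc[OF assms, of "map \<xi> [0..<n]" "\<xi> n"] by auto
  have "length (g (map \<xi> [0..<n])) = n"
    by (simp add: tree_automorphism_length[OF assms])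
  then have "boundary_act g \<xi> n = y"
    unfolding boundary_act_def y by (simp add: nth_append)
  then show ?case using y Suc by simp
qed

lemma tree_automorphism_inv:
  assumes "tree_automorphism g"
  shows "tree_automorphism (inv_into UNIV g)"
proof -
  have g: "bij g" "g [] = []" "\<And>u v. tree_adj (g u) (g v) \<longleftrightarrow> tree_adj u v"
    using assms by (auto simp: tree_automorphism_def)
  have "g (inv_into UNIV g w) = w" for w
    using g(1) by (simp add: bij_is_surj surj_f_inv_f)
  then have "tree_adj (inv_into UNIV g u) (inv_into UNIV g v) \<longleftrightarrow> tree_adj u v" for u v
    using g(3)[of "inv_into UNIV g u" "inv_into UNIV g v"] by simp
  moreover have "inv_into UNIV g [] = []"
    using g(1,2) by (metis bij_is_inj inv_f_f)
  ultimately show ?thesis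
    using g(1) by (simp add: tree_automorphism_def bij_imp_bij_inv)
qed

lemma group_AutT: "group AutT"
proof (rule groupI)
  fix g assume g: "g \<in> carrier AutT"
  then have "inv_into UNIV g \<circ> g = id"
    by (simp add: AutT_def tree_automorphism_def bij_is_inj)
  then show "\<exists>h\<in>carrier AutT. h \<otimes>\<^bsub>AutT\<^esub> g = \<one>\<^bsub>AutT\<^esub>"
    using tree_automorphism_inv[of g] g by (auto simp: AutT_def)
qed (auto simp: AutT_def tree_automorphism_def bij_comp)

lemma level_stab_antimono:
  assumes "m \<le> n"
  shows "level_stab n \<subseteq> level_stab m"
proof -
  have step: "level_stab (Suc k) \<subseteq> level_stab k" for k
  proof
    fix g assume g: "g \<in> level_stab (Suc k)"
    then have t: "tree_automorphism g" by (simp add: level_stab_def AutT_def)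
    have "g w = w" if "length w = k" for w
    proof -
      have "g (w @ [True]) = w @ [True]" using g that by (simp add: level_stab_def)
      moreover obtain y where "g (w @ [True]) = g w @ [y]"
        using tree_automorphism_snoc[OF t] by blast
      ultimately show ?thesis by (metis butlast_snoc)
    qed
    then show "g \<in> level_stab k" using g by (simp add: level_stab_def)
  qed
  show ?thesis using assms by (rule lift_Suc_antimono_le[of level_stab, OF step])
qed

lemma istopology_aut_open: "istopology aut_open"
  unfolding istopology_def
proof (intro conjI allI impI)
  fix S T assume S: "aut_open S" and T: "aut_open T"
  have "\<exists>n. g <#\<^bsub>AutT\<^esub> level_stab n \<subseteq> S \<inter> T" if "g \<in> S \<inter> T" for g
  proof -
    have g: "g \<in> S" "g \<in> T" using that by auto
    obtain m where "g <#\<^bsub>AutT\<^esub> level_stab m \<subseteq> S" using S g(1) unfolding aut_open_def by metis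
    moreover obtain n where "g <#\<^bsub>AutT\<^esub> level_stab n \<subseteq> T"
      using T g(2) unfolding aut_open_def by metis
    moreover have "level_stab (max m n) \<subseteq> level_stab m" "level_stab (max m n) \<subseteq> level_stab n"
      by (simp_all add: level_stab_antimono)
    moreover have "g <#\<^bsub>AutT\<^esub> A \<subseteq> g <#\<^bsub>AutT\<^esub> B" if "A \<subseteq> B" for A B
      unfolding l_coset_def using that by (rule UN_mono) simp
    ultimately have "g <#\<^bsub>AutT\<^esub> level_stab (max m n) \<subseteq> S \<inter> T"
      by (meson Int_greatest subset_trans)
    then show ?thesis by blast
  qed
  moreover have "S \<inter> T \<subseteq> carrier AutT" using S unfolding aut_open_def by auto
  ultimately show "aut_open (S \<inter> T)" unfolding aut_open_def by simp
next
  fix \<K> assume K: "\<forall>K\<in>\<K>. aut_open K"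
  have "\<exists>n. g <#\<^bsub>AutT\<^esub> level_stab n \<subseteq> \<Union>\<K>" if g: "g \<in> \<Union>\<K>" for g
  proof -
    obtain U where U: "U \<in> \<K>" "g \<in> U" using g by auto
    then obtain n where "g <#\<^bsub>AutT\<^esub> level_stab n \<subseteq> U"
      using K unfolding aut_open_def by meson
    then show ?thesis using U(1) by (meson Union_upper subset_trans)
  qed
  moreover have "\<Union>\<K> \<subseteq> carrier AutT"
    using K unfolding aut_open_def by (simp add: Union_least)
  ultimately show "aut_open (\<Union>\<K>)" unfolding aut_open_def by simp
qed

lemma openin_aut_topology: "openin aut_topology = aut_open"
  unfolding aut_topology_def by (rule topology_inverse'[OF istopology_aut_open])

lemma topspace_aut_topology: "topspace aut_topology = carrier AutT"
proof (rule antisym)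
  have "aut_open (topspace aut_topology)"
    unfolding openin_aut_topology[symmetric] by (rule openin_topspace)
  then show "topspace aut_topology \<subseteq> carrier AutT" by (simp add: aut_open_def)
  have "g <#\<^bsub>AutT\<^esub> level_stab 0 \<subseteq> carrier AutT" if "g \<in> carrier AutT" for g
    using group.l_coset_subset_G[OF group_AutT _ that] by (simp add: level_stab_def)
  then have "aut_open (carrier AutT)"
    unfolding aut_open_def by blast
  then show "carrier AutT \<subseteq> topspace aut_topology"
    unfolding openin_aut_topology[symmetric] by (rule openin_subset)
qed

lemma tree_automorphismI:
  assumes inv: "\<And>w. g (g w) = w" and nil: "g [] = []"
    and snoc: "\<And>w x. \<exists>y. g (w @ [x]) = g w @ [y]"
  shows "tree_automorphism g"
proof -
  have adj: "tree_adj (g u) (g v)" if "tree_adj u v" for u v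
    using that snoc unfolding tree_adj_def by blast
  have "tree_adj (g u) (g v) \<longleftrightarrow> tree_adj u v" for u v
    using adj[of u v] adj[of "g u" "g v"] inv by auto
  moreover have "bij g" using inv by (rule involuntory_imp_bij)
  ultimately show ?thesis
    unfolding tree_automorphism_def using nil by blast
qed

lemma grig_a_invol: "grig_a (grig_a w) = w"
  by (cases w) auto

lemma grig_bcd_invol:
  "grig_b (grig_b w) = w" "grig_c (grig_c w) = w" "grig_d (grig_d w) = w"
  by (induction w and w and w rule: grig_b_grig_c_grig_d.induct) (auto simp: grig_a_invol)

lemma grig_a_snoc: "\<exists>y. grig_a (w @ [x]) = grig_a w @ [y]"
  by (cases w) auto

lemma grig_bcd_snoc:
  "\<exists>y. grig_b (w @ [x]) = grig_b w @ [y]"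
  "\<exists>y. grig_c (w @ [x]) = grig_c w @ [y]"
  "\<exists>y. grig_d (w @ [x]) = grig_d w @ [y]"
proof (induction w and w and w rule: grig_b_grig_c_grig_d.induct)
  case 1 show ?case by (cases x) auto
next
  case 4 show ?case by (cases x) auto
next
  case 7 show ?case by (cases x) auto
qed (use grig_a_snoc in auto)

lemma grig_generators_automorphisms: "{grig_a, grig_b, grig_c, grig_d} \<subseteq> carrier AutT"
  by (auto simp: AutT_def intro!: tree_automorphismI grig_a_invol grig_bcd_invol
      grig_a_snoc grig_bcd_snoc)

end

theory Submission
  imports Defs
begin

text \<open>Let \<open>K\<close> be the normal closure of \<open>(ab)\<^sup>2\<close> in \<open>\<G>\<close>. It contains a copy of itself at every vertex,
  and two boundary points with the same first letter lie in one \<open>K\<close>-orbit as soon as they lie in one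
  \<open>\<G>\<close>-orbit. Given \<open>g\<close> in the closure of \<open>\<G>\<close> that keeps the points of a finite set in their
  \<open>\<G>\<close>-orbits, approximate it by \<open>h \<in> \<G>\<close> on a level where the images of these points are separated,
  and correct \<open>h\<close> at one point after the other by elements of the copies of \<open>K\<close> below that level, so
  that \<open>h\<close> and \<open>g\<close> agree on the whole set.\<close>

abbreviation finv :: "(bool list \<Rightarrow> bool list) \<Rightarrow> bool list \<Rightarrow> bool list" where
  "finv g \<equiv> inv_into UNIV g"

subsection \<open>Self-similarity\<close>

lemma Grigorchuk_subgroup: "subgroup Grigorchuk AutT"
  unfolding Grigorchuk_def
  by (rule group.generate_is_subgroup[OF group_AutT grig_generators_automorphisms])

lemma Grigorchuk_automorphism: "g \<in> Grigorchuk \<Longrightarrow> tree_automorphism g"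
  using subgroup.subset[OF Grigorchuk_subgroup] by (auto simp: AutT_def)

lemma Grigorchuk_inv_apply:
  assumes "g \<in> Grigorchuk"
  shows "finv g (g w) = w" "g (finv g w) = w"
  using Grigorchuk_automorphism[OF assms]
  by (simp_all add: tree_automorphism_def bij_is_inj bij_is_surj surj_f_inv_f)

lemma m_inv_AutT:
  assumes "g \<in> carrier AutT"
  shows "inv\<^bsub>AutT\<^esub> g = finv g"
proof (rule group.inv_equality[OF group_AutT _ assms])
  show "finv g \<otimes>\<^bsub>AutT\<^esub> g = \<one>\<^bsub>AutT\<^esub>"
    using assms by (simp add: AutT_def tree_automorphism_def bij_is_inj)
  show "finv g \<in> carrier AutT"
    using assms tree_automorphism_inv by (simp add: AutT_def)
qed

lemma Grigorchuk_id [simp]: "id \<in> Grigorchuk"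
  using subgroup.one_closed[OF Grigorchuk_subgroup] by (simp add: AutT_def)

lemma Grigorchuk_comp [simp]: "g \<in> Grigorchuk \<Longrightarrow> h \<in> Grigorchuk \<Longrightarrow> g \<circ> h \<in> Grigorchuk"
  using subgroup.m_closed[OF Grigorchuk_subgroup] by (simp add: AutT_def)

lemma Grigorchuk_inv [simp]:
  assumes "g \<in> Grigorchuk"
  shows "finv g \<in> Grigorchuk"
  using subgroup.m_inv_closed[OF Grigorchuk_subgroup assms]
    subgroup.subset[OF Grigorchuk_subgroup] assms m_inv_AutT[of g] by auto

lemma Grigorchuk_generators [simp]:
  "grig_a \<in> Grigorchuk" "grig_b \<in> Grigorchuk" "grig_c \<in> Grigorchuk" "grig_d \<in> Grigorchuk"
  unfolding Grigorchuk_def by (auto intro: generate.incl)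

lemma inv_grig [simp]:
  "finv grig_a = grig_a" "finv grig_b = grig_b" "finv grig_c = grig_c" "finv grig_d = grig_d"
  by (rule inv_equality; simp add: grig_a_invol grig_bcd_invol)+

declare grig_a_invol [simp] grig_bcd_invol [simp]

text \<open>Since the generators are involutions, every element is a product of generators without
  inverses.\<close>

lemma Grigorchuk_induct [consumes 1, case_names id step]:
  assumes "g \<in> Grigorchuk" and "P id"
    and step: "\<And>s h. s \<in> {grig_a, grig_b, grig_c, grig_d} \<Longrightarrow> h \<in> Grigorchuk \<Longrightarrow> P h \<Longrightarrow> P (s \<circ> h)"
  shows "P g"
proof -
  \<comment> \<open>Preservation of \<open>P\<close> under left multiplication by \<open>g\<close>
    is a property that passes to products, as the product case of \<open>generate\<close>
    demands.\<close>
  have "\<forall>h \<in> Grigorchuk. P h \<longrightarrow> P (g \<circ> h)"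
    using assms(1) unfolding Grigorchuk_def
  proof (induction rule: generate.induct)
    case one
    then show ?case by (simp add: AutT_def)
  next
    case (incl s)
    then show ?case using step[of s] unfolding Grigorchuk_def by blast
  next
    case (inv s)
    then have "inv\<^bsub>AutT\<^esub> s = s"
      using m_inv_AutT[of s] grig_generators_automorphisms by auto
    then show ?case using step[of s] inv unfolding Grigorchuk_def by (simp add: comp_def)
  next
    case (eng g1 g2)
    then show ?case
      using Grigorchuk_comp unfolding Grigorchuk_def by (simp add: AutT_def comp_def)
  qed
  then have "P (g \<circ> id)" using assms(2) Grigorchuk_id by blast
  then show ?thesis by simp
qed

lemma Grigorchuk_Nil [simp]: "g \<in> Grigorchuk \<Longrightarrow> g [] = []"
  using Grigorchuk_automorphism by (simp add: tree_automorphism_def)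

lemma Grigorchuk_length [simp]: "g \<in> Grigorchuk \<Longrightarrow> length (g w) = length w"
  using Grigorchuk_automorphism tree_automorphism_length by blast

text \<open>With \<open>id\<close>, the elements b, c, d form a Klein four-group. The induction is
  simultaneous because passing below the letter 1 cycles b to c to d to b.\<close>

lemma grig_klein_four:
  "grig_b (grig_c w) = grig_d w" "grig_c (grig_d w) = grig_b w" "grig_d (grig_b w) = grig_c w"
  by (induction w and w and w rule: grig_b_grig_c_grig_d.induct) auto

lemma grig_klein_four':
  "grig_c (grig_b w) = grig_d w" "grig_d (grig_c w) = grig_b w" "grig_b (grig_d w) = grig_c w"
  by (metis grig_klein_four grig_bcd_invol)+

lemma generator_section1:
  assumes "s \<in> {grig_a, grig_b, grig_c, grig_d}"
  shows "\<exists>y. \<exists>g'\<in>Grigorchuk. \<forall>w. s (x # w) = y # g' w"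
proof (cases "s = grig_a")
  case True
  then show ?thesis by (auto intro!: bexI[of _ id])
next
  case False
  then consider "s = grig_b" | "s = grig_c" | "s = grig_d" using assms by auto
  then show ?thesis
  proof cases
    case 1
    then show ?thesis
      by (cases x) (metis grig_b.simps(2,3) Grigorchuk_generators)+
  next
    case 2
    then show ?thesis
      by (cases x) (metis grig_c.simps(2,3) Grigorchuk_generators)+
  next
    case 3
    then show ?thesis
      by (cases x) (metis grig_d.simps(2,3) Grigorchuk_generators Grigorchuk_id id_apply)+
  qed
qed

text \<open>Sections compose: at \<open>x\<close>, the section of a product is the section of
  \<open>s\<close> at the image of \<open>x\<close> under \<open>h\<close>, applied after the
  section of \<open>h\<close> at \<open>x\<close>.\<close>

lemma Grigorchuk_section1:
  assumes "g \<in> Grigorchuk"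
  shows "\<exists>y. \<exists>g'\<in>Grigorchuk. \<forall>w. g (x # w) = y # g' w"
  using assms
proof (induction rule: Grigorchuk_induct)
  case id
  then show ?case by (auto intro!: bexI[of _ id])
next
  case (step s h)
  then obtain y h' where h': "h' \<in> Grigorchuk" "\<And>w. h (x # w) = y # h' w" by blast
  obtain z s' where s': "s' \<in> Grigorchuk" "\<And>w. s (y # w) = z # s' w"
    using generator_section1[OF step(1)] by blast
  show ?case
    by (rule exI[of _ z], rule bexI[of _ "s' \<circ> h'"]) (simp_all add: h' s')
qed

lemma Grigorchuk_section:
  assumes "g \<in> Grigorchuk"
  shows "\<exists>g'\<in>Grigorchuk. \<forall>w. g (v @ w) = g v @ g' w"
  using assms
proof (induction v arbitrary: g)
  case Nil
  then show ?case by auto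
next
  case (Cons x v)
  obtain y h where h: "h \<in> Grigorchuk" "\<And>w. g (x # w) = y # h w"
    using Grigorchuk_section1[OF Cons.prems] by blast
  then show ?case using Cons.IH[OF h(1)] by auto
qed

text \<open>Each generator is a section of some element fixing the vertex 1: aba = (c, a), d = (1,
  b), b = (a, c) and c = (a, d) have the sections a, b, c, d there.\<close>

lemma Grigorchuk_lift:
  assumes "g \<in> Grigorchuk"
  shows "\<exists>h\<in>Grigorchuk. \<forall>w. h (y # w) = y # g w"
  using assms
proof (induction rule: Grigorchuk_induct)
  case id
  then show ?case by (auto intro!: bexI[of _ id])
next
  case (step s h)
  then obtain h' where h': "h' \<in> Grigorchuk" "\<And>w. h' (y # w) = y # h w" by blast
  \<comment> \<open>Conjugation by \<open>grig_a\<close> swaps the two subtrees and so transports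
    lifts from the vertex 1 to the vertex 0.\<close>
  define f where "f t = (if y then t else grig_a \<circ> t \<circ> grig_a)" for t
  have f: "f t \<in> Grigorchuk" if "t \<in> Grigorchuk" for t
    using that by (simp add: f_def)
  have "\<exists>t\<in>Grigorchuk. \<forall>w. t (True # w) = True # s w"
    using step(1)
    by (elim insertE emptyE)
      (auto intro: bexI[of _ "grig_a \<circ> grig_b \<circ> grig_a"] bexI[of _ grig_d]
        bexI[of _ grig_b] bexI[of _ grig_c])
  then obtain t where t: "t \<in> Grigorchuk" "\<And>w. t (True # w) = True # s w" by blast
  have "(f t \<circ> h') (y # w) = y # (s \<circ> h) w" for w
    using h'(2)[of w] t(2)[of "h w"] by (cases y) (simp_all add: f_def)
  then show ?case using f[OF t(1)] h'(1) by (meson Grigorchuk_comp)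
qed

text \<open>A lift adjusts everything below the first letter, and \<open>grig_a\<close> changes that
  letter alone.\<close>

lemma Grigorchuk_level_transitive:
  "length u = length v \<Longrightarrow> \<exists>g\<in>Grigorchuk. g u = v"
proof (induction u v rule: list_induct2)
  case Nil
  show ?case by (rule bexI[of _ id]) simp_all
next
  case (Cons x u y v)
  then obtain g where g: "g \<in> Grigorchuk" "g u = v" by blast
  obtain h where h: "h \<in> Grigorchuk" "\<And>w. h (y # w) = y # g w"
    using Grigorchuk_lift[OF g(1)] by blast
  show ?case
  proof (cases "x = y")
    case True
    then show ?thesis using h g by auto
  next
    case False
    then have "(h \<circ> grig_a) (x # u) = y # v" using h g by (cases x; cases y) auto
    then show ?thesis using h(1) by (meson Grigorchuk_comp Grigorchuk_generators(1))
  qed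
qed

subsection \<open>Branching\<close>

definition grig_x :: "bool list \<Rightarrow> bool list" where
  "grig_x = grig_a \<circ> grig_b \<circ> grig_a \<circ> grig_b"

text \<open>Products of conjugates of \<open>grig_x\<close> are already closed under inversion,
  because the inverse of \<open>grig_x\<close> is its conjugate by \<open>grig_a\<close>. So this is
  the normal closure of \<open>grig_x\<close>.\<close>

inductive_set branch_K :: "(bool list \<Rightarrow> bool list) set" where
  id: "id \<in> branch_K"
| step: "g \<in> Grigorchuk \<Longrightarrow> k \<in> branch_K \<Longrightarrow> g \<circ> grig_x \<circ> finv g \<circ> k \<in> branch_K"

lemma grig_x_Grigorchuk [simp]: "grig_x \<in> Grigorchuk"
  by (simp add: grig_x_def)

lemma branch_K_Grigorchuk: "k \<in> branch_K \<Longrightarrow> k \<in> Grigorchuk"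
proof (induction rule: branch_K.induct)
  case id
  show "id \<in> Grigorchuk" by simp
next
  case (step g k)
  then show "g \<circ> grig_x \<circ> finv g \<circ> k \<in> Grigorchuk" by (intro Grigorchuk_comp) simp_all
qed

lemma branch_K_comp:
  assumes "k \<in> branch_K" "l \<in> branch_K"
  shows "k \<circ> l \<in> branch_K"
  using assms(1)
proof (induction rule: branch_K.induct)
  case id
  show "id \<circ> l \<in> branch_K" using assms(2) by simp
next
  case (step g k)
  have "g \<circ> grig_x \<circ> finv g \<circ> (k \<circ> l) \<in> branch_K" by (rule branch_K.step) (fact step)+
  then show "g \<circ> grig_x \<circ> finv g \<circ> k \<circ> l \<in> branch_K" by (simp only: comp_assoc)
qed

lemma inv_comp_Grigorchuk:
  "g \<in> Grigorchuk \<Longrightarrow> h \<in> Grigorchuk \<Longrightarrow> finv (g \<circ> h) = finv h \<circ> finv g"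
  using Grigorchuk_automorphism by (auto simp: tree_automorphism_def intro: o_inv_distrib)

lemma branch_K_conj:
  assumes "k \<in> branch_K" "h \<in> Grigorchuk"
  shows "h \<circ> k \<circ> finv h \<in> branch_K"
  using assms(1)
proof (induction rule: branch_K.induct)
  case id
  have "h \<circ> id \<circ> finv h = id"
    using assms(2) by (auto simp: fun_eq_iff Grigorchuk_inv_apply)
  then show ?case by (metis branch_K.id)
next
  case (step g k)
  have "h \<circ> (g \<circ> grig_x \<circ> finv g \<circ> k) \<circ> finv h
      = (h \<circ> g) \<circ> grig_x \<circ> finv (h \<circ> g) \<circ> (h \<circ> k \<circ> finv h)"
    using assms(2) step(1)
    by (auto simp: fun_eq_iff Grigorchuk_inv_apply inv_comp_Grigorchuk)
  moreover have "(h \<circ> g) \<circ> grig_x \<circ> finv (h \<circ> g) \<circ> (h \<circ> k \<circ> finv h) \<in> branch_K"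
    by (rule branch_K.step) (fact Grigorchuk_comp[OF assms(2) step(1)], fact step(3))
  ultimately show ?case by (simp only:)
qed

lemma grig_x_branch_K: "grig_x \<in> branch_K"
  using branch_K.step[OF Grigorchuk_id branch_K.id] by simp

lemma inv_grig_x: "finv grig_x = grig_a \<circ> grig_x \<circ> finv grig_a"
  by (rule inv_equality) (simp_all add: grig_x_def)

lemma branch_K_inv: "k \<in> branch_K \<Longrightarrow> finv k \<in> branch_K"
proof (induction rule: branch_K.induct)
  case id
  show "finv id \<in> branch_K" using branch_K.id by simp
next
  case (step g k)
  have "finv (g \<circ> grig_x \<circ> finv g \<circ> k) = finv k \<circ> (g \<circ> finv grig_x \<circ> finv g)"
    using step(1) branch_K_Grigorchuk[OF step(2)]
    by (intro inv_equality) (simp_all add: Grigorchuk_inv_apply)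
  moreover have "g \<circ> finv grig_x \<circ> finv g \<in> branch_K"
    unfolding inv_grig_x
    by (rule branch_K_conj[OF branch_K_conj[OF grig_x_branch_K]]) (simp_all add: step)
  ultimately show ?case using branch_K_comp[OF step(3)] by (simp only:)
qed

text \<open>In abab the letter a occurs an even number of times, so \<open>grig_x\<close> and all
  its conjugates fix the first level.\<close>

lemma branch_K_Cons: "k \<in> branch_K \<Longrightarrow> \<exists>w'. k (y # w) = y # w'"
proof (induction arbitrary: y w rule: branch_K.induct)
  case id
  then show ?case by simp
next
  case (step g k)
  obtain w1 where w1: "k (y # w) = y # w1" using step by blast
  obtain z h where h: "finv g (y # w) = z # h w" for w
    using Grigorchuk_section1[of "finv g" y] step(1) by auto
  have x: "\<exists>w'. grig_x (z # w) = z # w'" for w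
    by (cases z) (simp_all add: grig_x_def)
  obtain w2 where w2: "grig_x (z # h w1) = z # w2" using x by blast
  obtain y' h' where h': "g (z # w) = y' # h' w" for w
    using Grigorchuk_section1[OF step(1), of z] by auto
  have "g (finv g (y # w1)) = y # w1" using step(1) by (simp add: Grigorchuk_inv_apply)
  then have "y' = y" by (simp add: h h')
  then show ?case by (simp add: w1 h w2 h')
qed

section \<open>Copies of K below the vertices of the tree\<close>

definition graft1 :: "bool \<Rightarrow> (bool list \<Rightarrow> bool list) \<Rightarrow> bool list \<Rightarrow> bool list" where
  "graft1 y k w = (case w of [] \<Rightarrow> [] | z # u \<Rightarrow> if z = y then z # k u else w)"

lemma graft1_simps [simp]:
  "graft1 y k [] = []" "graft1 y k (y # w) = y # k w" "z \<noteq> y \<Longrightarrow> graft1 y k (z # w) = z # w"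
  by (simp_all add: graft1_def)

text \<open>The commutator of \<open>(ab)\<^sup>2 = (ca, ac)\<close> and \<open>d = (1, b)\<close> is \<open>(1, (ab)\<^sup>2)\<close>.\<close>

lemma graft1_grig_x: "graft1 y grig_x \<in> branch_K"
proof -
  have T: "graft1 True grig_x = grig_x \<circ> (grig_d \<circ> finv grig_x \<circ> finv grig_d)"
  proof
    fix w
    \<comment> \<open>The commutator has the section acbcab at 1; since b and c commute, cbc = b,
      which leaves abab.\<close>
    have "grig_a (grig_c (grig_b (grig_c (grig_a (grig_b u))))) = grig_x u" for u
      by (simp add: grig_x_def grig_klein_four grig_klein_four')
    then show "graft1 True grig_x w = (grig_x \<circ> (grig_d \<circ> finv grig_x \<circ> finv grig_d)) w"
      by (cases w rule: grig_d.cases) (simp_all add: inv_grig_x, simp_all add: grig_x_def)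
  qed
  have TK: "graft1 True grig_x \<in> branch_K"
    unfolding T by (intro branch_K_comp branch_K_conj branch_K_inv grig_x_branch_K) simp
  have "graft1 False grig_x = grig_a \<circ> graft1 True grig_x \<circ> finv grig_a"
  proof
    fix w show "graft1 False grig_x w = (grig_a \<circ> graft1 True grig_x \<circ> finv grig_a) w"
      by (cases w rule: grig_d.cases) simp_all
  qed
  then have "graft1 False grig_x \<in> branch_K"
    using branch_K_conj[OF TK Grigorchuk_generators(1)] by simp
  then show ?thesis using TK by (cases y) simp_all
qed

text \<open>The lift \<open>h\<close> may act nontrivially on the other subtree, but there the graft
  is trivial, so \<open>h\<close> and its inverse cancel.\<close>

lemma graft1_conj:
  assumes g: "g \<in> Grigorchuk" and h: "h \<in> Grigorchuk" "\<And>w. h (y # w) = y # g w"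
  shows "graft1 y (g \<circ> k \<circ> finv g) = h \<circ> graft1 y k \<circ> finv h"
proof
  fix w
  show "graft1 y (g \<circ> k \<circ> finv g) w = (h \<circ> graft1 y k \<circ> finv h) w"
  proof (cases w)
    case Nil
    then show ?thesis using h(1) by simp
  next
    case (Cons z u)
    show ?thesis
    proof (cases "z = y")
      case True
      have "finv h (y # u) = finv h (h (y # finv g u))"
        using h(2) g by (simp add: Grigorchuk_inv_apply)
      also have "\<dots> = y # finv g u" by (rule Grigorchuk_inv_apply(1)[OF h(1)])
      finally have "finv h (y # u) = y # finv g u" .
      then show ?thesis
        using True Cons h g by (simp add: Grigorchuk_inv_apply)
    next
      case False
      obtain z' h' where h': "finv h (z # u) = z' # h' u"
        using Grigorchuk_section1[of "finv h" z] h(1) by auto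
      have "h (z' # h' u) = z # u"
        using h' h(1) by (metis Grigorchuk_inv_apply(2))
      \<comment> \<open>\<open>h\<close> preserves the subtree below \<open>y\<close>, so its
        inverse cannot bring an outside word into it.\<close>
      have "z' \<noteq> y"
      proof
        assume "z' = y"
        then have "z # u = y # g (h' u)" using \<open>h (z' # h' u) = z # u\<close> h(2) by simp
        then show False using False by simp
      qed
      then show ?thesis
        using False Cons h' \<open>h (z' # h' u) = z # u\<close> by simp
    qed
  qed
qed

text \<open>Grafting respects composition and turns conjugation by \<open>g\<close> into conjugation
  by a lift of \<open>g\<close>, so the case of \<open>grig_x\<close> suffices.\<close>

lemma graft1_branch_K: "k \<in> branch_K \<Longrightarrow> graft1 y k \<in> branch_K"
proof (induction rule: branch_K.induct)
  case id
  have "graft1 y id = id" by (auto simp: graft1_def fun_eq_iff split: list.split)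
  then show "graft1 y id \<in> branch_K" by (simp add: branch_K.id)
next
  case (step g k)
  obtain h where h: "h \<in> Grigorchuk" "\<And>w. h (y # w) = y # g w"
    using Grigorchuk_lift[OF step(1)] by blast
  have "graft1 y (g \<circ> grig_x \<circ> finv g \<circ> k) = graft1 y (g \<circ> grig_x \<circ> finv g) \<circ> graft1 y k"
    by (auto simp: graft1_def fun_eq_iff split: list.split)
  also have "\<dots> = h \<circ> graft1 y grig_x \<circ> finv h \<circ> graft1 y k"
    using graft1_conj[OF step(1) h] by simp
  finally show ?case
    using branch_K_comp[OF branch_K_conj[OF graft1_grig_x h(1)] step(3)] by (simp only:)
qed

definition graft :: "bool list \<Rightarrow> (bool list \<Rightarrow> bool list) \<Rightarrow> bool list \<Rightarrow> bool list" where
  "graft v k = foldr graft1 v k"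

lemma graft_branch_K: "k \<in> branch_K \<Longrightarrow> graft v k \<in> branch_K"
  by (induction v) (simp_all add: graft_def graft1_branch_K)

lemma graft_append: "graft v k (v @ w) = v @ k w"
  by (induction v) (simp_all add: graft_def)

lemma graft_outside:
  "length u = length v \<Longrightarrow> u \<noteq> v \<Longrightarrow> graft v k (u @ w) = u @ w"
proof (induction u v rule: list_induct2)
  case Nil
  then show ?case by simp
next
  case (Cons x u y v)
  then show ?case by (cases "x = y") (simp_all add: graft_def)
qed

text \<open>K fixes the first level, so a graft at depth n is still trivial on level n + 1.
  Corrections by grafts therefore preserve an approximation on that level.\<close>

lemma graft_short:
  assumes "k \<in> branch_K" "length w = Suc (length v)"
  shows "graft v k w = w"
proof -
  obtain u x where w: "w = u @ [x]" "length u = length v"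
    using assms(2) by (metis length_Suc_conv_rev)
  obtain w' where "k [x] = x # w'" using branch_K_Cons[OF assms(1)] by blast
  moreover have "length (k [x]) = 1" using branch_K_Grigorchuk[OF assms(1)] by simp
  ultimately have "k [x] = [x]" by simp
  then show ?thesis using w graft_append[of v k "[x]"] graft_outside[of u v k "[x]"] by metis
qed

subsection \<open>Boundary points\<close>

abbreviation pre :: "nat \<Rightarrow> (nat \<Rightarrow> bool) \<Rightarrow> bool list" where
  "pre n \<xi> \<equiv> map \<xi> [0..<n]"

definition conc :: "bool list \<Rightarrow> (nat \<Rightarrow> bool) \<Rightarrow> (nat \<Rightarrow> bool)" where
  "conc v \<xi> = (\<lambda>i. if i < length v then v ! i else \<xi> (i - length v))"

lemma pre_inject:
  assumes "\<And>n. pre n \<xi> = pre n \<eta>"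
  shows "\<xi> = \<eta>"
proof
  fix i
  have "pre (Suc i) \<xi> ! i = pre (Suc i) \<eta> ! i" using assms by metis
  then show "\<xi> i = \<eta> i" by (simp del: upt_Suc)
qed

lemma pre_antimono: "pre n \<xi> = pre n \<eta> \<Longrightarrow> m \<le> n \<Longrightarrow> pre m \<xi> = pre m \<eta>"
  by (auto simp: map_eq_conv)

lemma pre_conc: "pre (length v + m) (conc v \<xi>) = v @ pre m \<xi>"
  by (rule nth_equalityI) (auto simp: conc_def nth_append)

lemma pre_length_conc: "pre (length v) (conc v \<xi>) = v"
  using pre_conc[of v \<xi> 0] by simp

lemma conc_pre: "conc (pre n \<xi>) (\<lambda>i. \<xi> (n + i)) = \<xi>"
  by (auto simp: conc_def fun_eq_iff)

lemma conc_cases: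
  obtains v \<eta> where "\<xi> = conc v \<eta>" "length v = n" "pre n \<xi> = v"
  using conc_pre[of \<xi> n] by (metis length_map length_upt diff_zero)

lemma boundary_actI:
  assumes g: "tree_automorphism g" and eq: "\<And>n. g (pre n \<xi>) = pre n \<eta>"
  shows "boundary_act g \<xi> = \<eta>"
  by (rule pre_inject) (simp add: boundary_act_prefix[OF g] eq)

lemma pre_boundary_act:
  "g \<in> Grigorchuk \<Longrightarrow> pre n (boundary_act g \<xi>) = g (pre n \<xi>)"
  by (simp add: boundary_act_prefix Grigorchuk_automorphism)

lemma boundary_act_comp:
  assumes "g \<in> Grigorchuk" "h \<in> Grigorchuk"
  shows "boundary_act (g \<circ> h) \<xi> = boundary_act g (boundary_act h \<xi>)"
  by (rule boundary_actI)
    (simp_all add: assms Grigorchuk_automorphism[OF Grigorchuk_comp[OF assms]] pre_boundary_act)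

lemma boundary_act_id: "boundary_act id \<xi> = \<xi>"
  by (rule boundary_actI) (simp_all add: Grigorchuk_automorphism)

lemma boundary_act_inv:
  assumes "g \<in> Grigorchuk"
  shows "boundary_act (finv g) (boundary_act g \<xi>) = \<xi>" "boundary_act g (boundary_act (finv g) \<xi>) = \<xi>"
  by (simp_all only: pre_boundary_act Grigorchuk_inv_apply assms Grigorchuk_inv pre_inject)

text \<open>Sections carried over to the boundary; with \<open>h = id\<close> this describes how a
  whole cylinder is fixed or merely relabelled.\<close>

lemma boundary_act_conc:
  assumes g: "tree_automorphism g" and h: "tree_automorphism h"
    and sec: "\<And>w. g (v @ w) = u @ h w" and len: "length u = length v"
  shows "boundary_act g (conc v \<xi>) = conc u (boundary_act h \<xi>)"
proof (rule pre_inject)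
  fix n
  have "pre (length v + n) (boundary_act g (conc v \<xi>)) = g (v @ pre n \<xi>)"
    by (simp only: boundary_act_prefix[OF g] pre_conc)
  also have "\<dots> = pre (length u + n) (conc u (boundary_act h \<xi>))"
    by (simp only: sec boundary_act_prefix[OF h] pre_conc)
  finally show "pre n (boundary_act g (conc v \<xi>)) = pre n (conc u (boundary_act h \<xi>))"
    using len by (auto intro: pre_antimono)
qed

subsection \<open>Orbits of the branching subgroup\<close>

text \<open>Modulo K, b is central: it commutes with c and d, and its commutator with a is a
  conjugate of \<open>grig_x\<close>. Products are handled by [b, sh] = [b, s] s[b, h]s^-1.\<close>

lemma commutator_b_branch_K:
  "g \<in> Grigorchuk \<Longrightarrow> grig_b \<circ> (g \<circ> grig_b \<circ> finv g) \<in> branch_K"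
proof (induction rule: Grigorchuk_induct)
  case id
  have "grig_b \<circ> (id \<circ> grig_b \<circ> finv id) = id" by (simp add: fun_eq_iff)
  then show ?case using branch_K.id by (simp only:)
next
  case (step s h)
  have s: "s \<in> Grigorchuk" using step(1) by auto
  have "grig_b \<circ> s \<circ> grig_b \<circ> finv s \<in> branch_K"
  proof (cases "s = grig_a")
    case True
    have "grig_b \<circ> s \<circ> grig_b \<circ> finv s = grig_a \<circ> grig_x \<circ> finv grig_a"
      unfolding True by (simp add: grig_x_def fun_eq_iff)
    then show ?thesis using branch_K_conj[OF grig_x_branch_K, of grig_a] by simp
  next
    case False
    then have "grig_b \<circ> s \<circ> grig_b \<circ> finv s = id"
      using step(1) by (elim insertE emptyE) (auto intro!: ext simp: grig_klein_four grig_klein_four')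
    then show ?thesis by (simp add: branch_K.id)
  qed
  from branch_K_comp[OF this branch_K_conj[OF step(3) s]]
  have "grig_b \<circ> s \<circ> grig_b \<circ> finv s \<circ> (s \<circ> (grig_b \<circ> (h \<circ> grig_b \<circ> finv h)) \<circ> finv s) \<in> branch_K" .
  also have "grig_b \<circ> s \<circ> grig_b \<circ> finv s \<circ> (s \<circ> (grig_b \<circ> (h \<circ> grig_b \<circ> finv h)) \<circ> finv s)
      = grig_b \<circ> (s \<circ> h \<circ> grig_b \<circ> finv (s \<circ> h))"
    using s step(2) by (simp add: fun_eq_iff Grigorchuk_inv_apply inv_comp_Grigorchuk)
  finally show ?case .
qed

text \<open>The elements that preserve every \<open>K\<close>-orbit on the boundary form a normal subgroup; it turns out
  to be the stabilizer of the first level.\<close>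

definition locally_K :: "(bool list \<Rightarrow> bool list) set" where
  "locally_K = {g \<in> Grigorchuk. \<forall>\<xi>. \<exists>k\<in>branch_K. boundary_act g \<xi> = boundary_act k \<xi>}"

lemma locally_K_Grigorchuk: "g \<in> locally_K \<Longrightarrow> g \<in> Grigorchuk"
  by (simp add: locally_K_def)

lemma locally_K_id: "id \<in> locally_K"
  using branch_K.id by (auto simp: locally_K_def)

lemma locally_K_comp:
  assumes "g \<in> locally_K" "h \<in> locally_K"
  shows "g \<circ> h \<in> locally_K"
proof -
  have "\<exists>k\<in>branch_K. boundary_act (g \<circ> h) \<xi> = boundary_act k \<xi>" for \<xi>
  proof -
    obtain k where k: "k \<in> branch_K" "boundary_act h \<xi> = boundary_act k \<xi>"
      using assms(2) by (auto simp: locally_K_def)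
    obtain l where l: "l \<in> branch_K" "boundary_act g (boundary_act h \<xi>) = boundary_act l (boundary_act h \<xi>)"
      using assms(1) unfolding locally_K_def by blast
    show ?thesis
      using k l assms branch_K_comp[OF l(1) k(1)]
      by (metis boundary_act_comp branch_K_Grigorchuk locally_K_Grigorchuk)
  qed
  then show ?thesis using assms by (simp add: locally_K_def)
qed

lemma locally_K_conj:
  assumes "g \<in> locally_K" "h \<in> Grigorchuk"
  shows "h \<circ> g \<circ> finv h \<in> locally_K"
proof -
  have "\<exists>k\<in>branch_K. boundary_act (h \<circ> g \<circ> finv h) \<xi> = boundary_act k \<xi>" for \<xi>
  proof -
    obtain k where k: "k \<in> branch_K"
      "boundary_act g (boundary_act (finv h) \<xi>) = boundary_act k (boundary_act (finv h) \<xi>)"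
      using assms(1) unfolding locally_K_def by blast
    show ?thesis
      by (rule bexI[OF _ branch_K_conj[OF k(1) assms(2)]])
        (simp add: boundary_act_comp assms locally_K_Grigorchuk branch_K_Grigorchuk k)
  qed
  then show ?thesis using assms by (simp add: locally_K_def)
qed

text \<open>The conjugate of \<open>finv s\<close> by \<open>g\<close> fixes \<open>\<xi>\<close>,
  so \<open>s\<close> agrees at \<open>\<xi>\<close> with the commutator, which lies in K.\<close>

lemma boundary_act_commutator:
  assumes "s \<in> Grigorchuk" "g \<in> Grigorchuk"
    and "boundary_act (finv s) (boundary_act (finv g) \<xi>) = boundary_act (finv g) \<xi>"
    and "s \<circ> (g \<circ> finv s \<circ> finv g) \<in> branch_K"
  shows "\<exists>k\<in>branch_K. boundary_act s \<xi> = boundary_act k \<xi>"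
proof (rule bexI[OF _ assms(4)])
  show "boundary_act s \<xi> = boundary_act (s \<circ> (g \<circ> finv s \<circ> finv g)) \<xi>"
    using assms(1-3) by (simp add: boundary_act_comp boundary_act_inv)
qed

text \<open>Every boundary point can be moved below the vertex \<open>110\<close>, where \<open>b\<close> acts trivially.\<close>

lemma grig_b_locally_K: "grig_b \<in> locally_K"
proof -
  have "\<exists>k\<in>branch_K. boundary_act grig_b \<xi> = boundary_act k \<xi>" for \<xi>
  proof -
    obtain g where g: "g \<in> Grigorchuk" "g (pre 3 \<xi>) = [True, True, False]"
      using Grigorchuk_level_transitive[of "pre 3 \<xi>" "[True, True, False]"] by auto
    obtain \<eta> where \<eta>: "boundary_act g \<xi> = conc [True, True, False] \<eta>"
      using conc_cases[of "boundary_act g \<xi>" 3] g pre_boundary_act by metis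
    \<comment> \<open>Along 11 the section of b becomes first c and then d, and d is trivial below
      0.\<close>
    have "boundary_act grig_b (conc [True, True, False] \<eta>)
        = conc [True, True, False] (boundary_act id \<eta>)"
      by (rule boundary_act_conc) (simp_all add: Grigorchuk_automorphism)
    then have "boundary_act grig_b (boundary_act g \<xi>) = boundary_act g \<xi>"
      by (simp add: \<eta> boundary_act_id)
    \<comment> \<open>The conjugating element is \<open>finv g\<close>, whose inverse
      \<open>g\<close> carries \<open>\<xi>\<close> into the cylinder fixed by b.\<close>
    then show ?thesis
      using boundary_act_commutator[of grig_b "finv g" \<xi>] commutator_b_branch_K[of "finv g"] g(1)
        Grigorchuk_automorphism[OF g(1)]
      by (simp add: tree_automorphism_def inv_inv_eq)
  qed
  then show ?thesis by (simp add: locally_K_def)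
qed

text \<open>Below \<open>0\<close> the element \<open>d\<close> is trivial. Below \<open>1\<close> it agrees modulo \<open>b\<close> with \<open>c = (a, d)\<close>, which
  is trivial below \<open>10\<close>; the element \<open>aba = (c, a)\<close> commutes with \<open>c\<close> modulo \<open>K\<close> and exchanges
  the vertices \<open>10\<close> and \<open>11\<close>.\<close>

lemma grig_d_locally_K: "grig_d \<in> locally_K"
proof -
  let ?t = "grig_a \<circ> grig_b \<circ> grig_a"
  have inv_t: "finv ?t = ?t" by (rule inv_equality) simp_all
  have fix10: "boundary_act grig_c (conc [True, False] \<eta>) = conc [True, False] \<eta>" for \<eta>
    using boundary_act_conc[of grig_c id "[True, False]" "[True, False]" \<eta>]
    by (simp add: Grigorchuk_automorphism boundary_act_id)
  have move: "boundary_act ?t (conc [True, True] \<eta>) = conc [True, False] \<eta>" for \<eta>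
    using boundary_act_conc[of ?t id "[True, True]" "[True, False]" \<eta>]
    by (simp add: Grigorchuk_automorphism boundary_act_id)
  \<comment> \<open>\<open>?k\<close> is the commutator of b and a, and \<open>?t\<close> equals b
    times \<open>?k\<close>. As b and c commute, the commutator of c and \<open>?t\<close> is the
    b-conjugate of that of c and \<open>?k\<close>.\<close>
  let ?k = "grig_b \<circ> (grig_a \<circ> grig_b \<circ> finv grig_a)"
  have "finv ?k = grig_a \<circ> grig_b \<circ> grig_a \<circ> grig_b" by (rule inv_equality) simp_all
  then have "grig_c \<circ> (?t \<circ> grig_c \<circ> ?t)
      = grig_b \<circ> ((grig_c \<circ> ?k \<circ> finv grig_c) \<circ> finv ?k) \<circ> finv grig_b"
    by (simp add: fun_eq_iff grig_klein_four grig_klein_four')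
  moreover have "grig_b \<circ> ((grig_c \<circ> ?k \<circ> finv grig_c) \<circ> finv ?k) \<circ> finv grig_b \<in> branch_K"
    by (intro branch_K_comp branch_K_conj branch_K_inv commutator_b_branch_K Grigorchuk_generators)
  ultimately have comm: "grig_c \<circ> (?t \<circ> grig_c \<circ> ?t) \<in> branch_K" by (simp only:)
  have c1: "\<exists>k\<in>branch_K. boundary_act grig_c \<xi> = boundary_act k \<xi>" if "\<xi> 0" for \<xi>
  proof (cases "\<xi> 1")
    case False
    then have "pre 2 \<xi> = [True, False]" using that by (simp add: numeral_2_eq_2)
    then obtain \<eta> where "\<xi> = conc [True, False] \<eta>" using conc_cases[of \<xi> 2] by metis
    then have "boundary_act grig_c \<xi> = boundary_act id \<xi>" by (simp add: fix10 boundary_act_id)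
    then show ?thesis using branch_K.id by blast
  next
    case True
    then have "pre 2 \<xi> = [True, True]" using that by (simp add: numeral_2_eq_2)
    then obtain \<eta> where "\<xi> = conc [True, True] \<eta>" using conc_cases[of \<xi> 2] by metis
    then show ?thesis
      using boundary_act_commutator[of grig_c ?t \<xi>] comm by (simp only: inv_t move) (simp add: fix10)
  qed
  have b: "\<exists>k\<in>branch_K. boundary_act grig_b \<xi> = boundary_act k \<xi>" for \<xi>
    using grig_b_locally_K by (simp add: locally_K_def)
  have "\<exists>k\<in>branch_K. boundary_act grig_d \<xi> = boundary_act k \<xi>" for \<xi>
  proof (cases "\<xi> 0")
    case False
    then have "pre 1 \<xi> = [False]" by simp
    then obtain \<eta> where \<xi>: "\<xi> = conc [False] \<eta>" using conc_cases[of \<xi> 1] by metis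
    then have "boundary_act grig_d \<xi> = boundary_act id \<xi>"
      using boundary_act_conc[of grig_d id "[False]" "[False]" \<eta>]
      by (simp add: Grigorchuk_automorphism boundary_act_id)
    then show ?thesis using branch_K.id by blast
  next
    case True
    obtain k where k: "k \<in> branch_K" "boundary_act grig_c \<xi> = boundary_act k \<xi>"
      using c1 True by blast
    obtain l where l: "l \<in> branch_K"
      "boundary_act grig_b (boundary_act grig_c \<xi>) = boundary_act l (boundary_act grig_c \<xi>)"
      using b by blast
    have d: "grig_d = grig_b \<circ> grig_c" by (simp add: fun_eq_iff grig_klein_four)
    have "boundary_act grig_d \<xi> = boundary_act (l \<circ> k) \<xi>"
      unfolding d using k l by (simp add: boundary_act_comp branch_K_Grigorchuk)
    then show ?thesis using branch_K_comp[OF l(1) k(1)] by blast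
  qed
  then show ?thesis by (simp add: locally_K_def)
qed

text \<open>The normal subgroup \<open>locally_K\<close> contains b, d and c = db, so only the
  cosets of \<open>id\<close> and \<open>grig_a\<close> remain.\<close>

lemma Grigorchuk_locally_K_cases:
  "g \<in> Grigorchuk \<Longrightarrow> g \<in> locally_K \<or> g \<circ> grig_a \<in> locally_K"
proof (induction rule: Grigorchuk_induct)
  case id
  show "id \<in> locally_K \<or> id \<circ> grig_a \<in> locally_K" using locally_K_id by simp
next
  case (step s h)
  show ?case
  proof (cases "s = grig_a")
    case True
    have conj: "grig_a \<circ> g \<circ> grig_a \<in> locally_K" if "g \<in> locally_K" for g
      using locally_K_conj[OF that, of grig_a] by simp
    have "(grig_a \<circ> (h \<circ> grig_a)) \<circ> grig_a = grig_a \<circ> h" by (simp add: fun_eq_iff)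
    then show ?thesis using step(3) conj[of h] conj[of "h \<circ> grig_a"] True by metis
  next
    case False
    have "grig_c = grig_d \<circ> grig_b" by (simp add: fun_eq_iff grig_klein_four)
    then have "s \<in> locally_K"
      using False step(1) locally_K_comp[OF grig_d_locally_K grig_b_locally_K]
        grig_b_locally_K grig_d_locally_K by auto
    then show ?thesis using step(3) locally_K_comp by (metis comp_assoc)
  qed
qed

lemma boundary_act_branch_K_0:
  assumes "k \<in> branch_K"
  shows "boundary_act k \<xi> 0 = \<xi> 0"
  using branch_K_Cons[OF assms, of "\<xi> 0" "[]"] by (auto simp: boundary_act_def)

text \<open>Otherwise \<open>g \<circ> grig_a\<close> lies in \<open>locally_K\<close>, so
  \<open>g\<close> would send \<open>\<xi>\<close> into the K-orbit of its image under
  \<open>grig_a\<close>, where the first letter is flipped.\<close>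

lemma branch_K_orbit:
  assumes g: "g \<in> Grigorchuk" and eq: "boundary_act g \<xi> 0 = \<xi> 0"
  shows "\<exists>k\<in>branch_K. boundary_act g \<xi> = boundary_act k \<xi>"
proof (rule ccontr)
  assume "\<not> ?thesis"
  then have "g \<circ> grig_a \<in> locally_K"
    using Grigorchuk_locally_K_cases[OF g] by (auto simp: locally_K_def)
  then obtain k where k: "k \<in> branch_K"
    "boundary_act (g \<circ> grig_a) (boundary_act grig_a \<xi>) = boundary_act k (boundary_act grig_a \<xi>)"
    unfolding locally_K_def by blast
  moreover have "g \<circ> grig_a \<circ> grig_a = g" by (simp add: fun_eq_iff)
  ultimately have "boundary_act g \<xi> = boundary_act k (boundary_act grig_a \<xi>)"
    using g boundary_act_comp[of "g \<circ> grig_a" grig_a \<xi>] by simp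
  then have "boundary_act g \<xi> 0 = boundary_act grig_a \<xi> 0"
    using boundary_act_branch_K_0[OF k(1)] by simp
  then show False using eq by (simp add: boundary_act_def)
qed

text \<open>At this point the section of \<open>g\<close> at the prefix of length \<open>n\<close>
  can be replaced by an element of K, which can be grafted. The extra common letter makes
  \<open>branch_K_orbit\<close> applicable to the tail.\<close>

lemma rigid_correction:
  assumes g: "g \<in> Grigorchuk" and eq: "pre (Suc n) (boundary_act g \<xi>) = pre (Suc n) \<xi>"
  shows "\<exists>k\<in>branch_K. boundary_act (graft (pre n \<xi>) k) \<xi> = boundary_act g \<xi>"
proof -
  let ?v = "pre n \<xi>" and ?\<eta> = "\<lambda>i. \<xi> (n + i)"
  have \<xi>: "\<xi> = conc ?v ?\<eta>" by (simp add: conc_pre)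
  have "g ?v = ?v"
    using pre_antimono[OF eq, where m = n] pre_boundary_act[OF g] by simp
  then obtain g' where g': "g' \<in> Grigorchuk" "\<And>w. g (?v @ w) = ?v @ g' w"
    using Grigorchuk_section[OF g, of ?v] by auto
  have act: "boundary_act g (conc ?v ?\<eta>) = conc ?v (boundary_act g' ?\<eta>)"
    by (rule boundary_act_conc) (simp_all add: g g' Grigorchuk_automorphism)
  have "boundary_act g \<xi> n = \<xi> n"
    using eq by simp
  moreover have "boundary_act g \<xi> n = boundary_act g' ?\<eta> 0"
    using act unfolding \<xi>[symmetric] by (simp add: conc_def)
  ultimately obtain k where k: "k \<in> branch_K" "boundary_act g' ?\<eta> = boundary_act k ?\<eta>"
    using branch_K_orbit[OF g'(1), of ?\<eta>] by auto
  have "boundary_act (graft ?v k) (conc ?v ?\<eta>) = conc ?v (boundary_act k ?\<eta>)"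
    by (rule boundary_act_conc)
      (simp_all add: k graft_append graft_branch_K branch_K_Grigorchuk Grigorchuk_automorphism)
  then show ?thesis using k act \<xi> by metis
qed

subsection \<open>The closure\<close>

lemma l_coset_level_stab:
  assumes g: "g \<in> carrier AutT"
  shows "g <#\<^bsub>AutT\<^esub> level_stab n = {h \<in> carrier AutT. \<forall>w. length w = n \<longrightarrow> h w = g w}"
proof (intro equalityI subsetI)
  fix h assume "h \<in> g <#\<^bsub>AutT\<^esub> level_stab n"
  then obtain s where "s \<in> level_stab n" "h = g \<circ> s"
    by (auto simp: l_coset_def AutT_def)
  then show "h \<in> {h \<in> carrier AutT. \<forall>w. length w = n \<longrightarrow> h w = g w}"
    using monoid.m_closed[OF group.is_monoid[OF group_AutT] g, of s]
    by (auto simp: level_stab_def AutT_def)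
next
  fix h assume h: "h \<in> {h \<in> carrier AutT. \<forall>w. length w = n \<longrightarrow> h w = g w}"
  have "finv g \<in> carrier AutT" using g tree_automorphism_inv by (simp add: AutT_def)
  then have "finv g \<circ> h \<in> carrier AutT"
    using monoid.m_closed[OF group.is_monoid[OF group_AutT], of "finv g" h] h by (simp add: AutT_def)
  moreover have "finv g (g w) = w" "g (finv g w) = w" for w
    using g by (simp_all add: AutT_def tree_automorphism_def bij_is_inj bij_is_surj surj_f_inv_f)
  ultimately have "finv g \<circ> h \<in> level_stab n" "h = g \<circ> (finv g \<circ> h)"
    using h by (auto simp: level_stab_def)
  then show "h \<in> g <#\<^bsub>AutT\<^esub> level_stab n" by (auto simp: l_coset_def AutT_def)
qed

text \<open>The cosets of the level stabilizers are basic neighbourhoods, and lying in one means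
  agreeing on one level.\<close>

lemma in_closure_aut_topology:
  assumes H: "H \<subseteq> carrier AutT"
  shows "g \<in> aut_topology closure_of H \<longleftrightarrow>
    g \<in> carrier AutT \<and> (\<forall>n. \<exists>h\<in>H. \<forall>w. length w = n \<longrightarrow> h w = g w)"
    (is "_ \<longleftrightarrow> ?R")
proof
  assume cl: "g \<in> aut_topology closure_of H"
  then have g: "g \<in> carrier AutT" by (simp add: in_closure_of topspace_aut_topology)
  have "\<exists>h\<in>H. \<forall>w. length w = n \<longrightarrow> h w = g w" for n
  proof -
    have "aut_open (g <#\<^bsub>AutT\<^esub> level_stab n)"
      unfolding aut_open_def
    proof (intro conjI ballI exI)
      fix h assume "h \<in> g <#\<^bsub>AutT\<^esub> level_stab n"
      then have h: "h \<in> carrier AutT" "\<forall>w. length w = n \<longrightarrow> h w = g w"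
        by (simp_all add: l_coset_level_stab g)
      show "h <#\<^bsub>AutT\<^esub> level_stab n \<subseteq> g <#\<^bsub>AutT\<^esub> level_stab n"
        unfolding l_coset_level_stab[OF g] l_coset_level_stab[OF h(1)] using h(2) by auto
    qed (auto simp: l_coset_level_stab g)
    moreover have "g \<in> g <#\<^bsub>AutT\<^esub> level_stab n" using g by (simp add: l_coset_level_stab)
    ultimately obtain h where "h \<in> H" "h \<in> g <#\<^bsub>AutT\<^esub> level_stab n"
      using cl unfolding in_closure_of openin_aut_topology by blast
    then show ?thesis by (auto simp: l_coset_level_stab g)
  qed
  then show ?R using g by blast
next
  assume R: ?R
  have "\<exists>h. h \<in> H \<and> h \<in> U" if U: "g \<in> U" "aut_open U" for U
  proof -
    obtain n where "g <#\<^bsub>AutT\<^esub> level_stab n \<subseteq> U" using U unfolding aut_open_def by meson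
    moreover obtain h where "h \<in> H" "\<forall>w. length w = n \<longrightarrow> h w = g w" using R by blast
    ultimately show ?thesis using H R by (auto simp: l_coset_level_stab)
  qed
  then show "g \<in> aut_topology closure_of H"
    using R unfolding in_closure_of openin_aut_topology topspace_aut_topology by blast
qed

lemma agree_level_antimono:
  assumes "tree_automorphism g" "tree_automorphism h" "m \<le> n"
    and eq: "\<And>w. length w = n \<Longrightarrow> h w = g w" and w: "length w = m"
  shows "h w = g w"
proof -
  \<comment> \<open>The tail is arbitrary padding that extends \<open>w\<close> to level
    \<open>n\<close>.\<close>
  let ?\<xi> = "conc w (\<lambda>_. False)"
  have "pre n (boundary_act h ?\<xi>) = pre n (boundary_act g ?\<xi>)"
    by (simp add: boundary_act_prefix assms(1,2) eq)
  then have "pre m (boundary_act h ?\<xi>) = pre m (boundary_act g ?\<xi>)"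
    using pre_antimono assms(3) by blast
  then show ?thesis
    using w pre_length_conc[of w] by (simp add: boundary_act_prefix assms(1,2))
qed

section \<open>Correcting an approximation at finitely many boundary points\<close>

lemma finite_separating_level:
  assumes "finite C"
  shows "\<exists>n. inj_on (pre n) C"
  using assms
proof (induction rule: finite_induct)
  case empty
  then show ?case by simp
next
  case (insert \<xi> C)
  then obtain n where n: "inj_on (pre n) C" by blast
  have "\<exists>m. \<forall>\<eta>\<in>C. pre m \<xi> \<noteq> pre m \<eta>"
  proof -
    have "\<forall>\<eta>\<in>C. \<exists>m. pre m \<xi> \<noteq> pre m \<eta>" using insert(2) pre_inject by metis
    then obtain f where f: "\<And>\<eta>. \<eta> \<in> C \<Longrightarrow> pre (f \<eta>) \<xi> \<noteq> pre (f \<eta>) \<eta>" by metis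
    have "pre (Max (f ` C)) \<xi> \<noteq> pre (Max (f ` C)) \<eta>" if "\<eta> \<in> C" for \<eta>
      using f[OF that] pre_antimono[of \<xi> "Max (f ` C)" \<eta> "f \<eta>"] that insert(1) by auto
    then show ?thesis by blast
  qed
  then obtain m where m: "\<And>\<eta>. \<eta> \<in> C \<Longrightarrow> pre m \<xi> \<noteq> pre m \<eta>" by blast
  have "inj_on (pre (max m n)) (insert \<xi> C)"
  proof (rule inj_onI)
    fix x y assume xy: "x \<in> insert \<xi> C" "y \<in> insert \<xi> C" "pre (max m n) x = pre (max m n) y"
    have "pre m x = pre m y" "pre n x = pre n y"
      by (rule pre_antimono[OF xy(3)], simp)+
    then show "x = y" using xy(1,2) m n by (metis inj_onD insertE)
  qed
  then show ?case by blast
qed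

text \<open>The assumption \<open>orb\<close> covers both applications: it is witnessed by
  \<open>id\<close> when \<open>g\<close> fixes \<open>C\<close> pointwise, and follows from a
  common orbit when \<open>g\<close> permutes \<open>C\<close>.\<close>

lemma approximation_on_finite_set:
  assumes g: "g \<in> aut_topology closure_of Grigorchuk" and "finite C"
    and orb: "\<And>\<xi>. \<xi> \<in> C \<Longrightarrow> \<exists>s\<in>Grigorchuk. boundary_act g \<xi> = boundary_act s \<xi>"
  shows "\<exists>h\<in>Grigorchuk. (\<forall>w. length w = n \<longrightarrow> h w = g w) \<and>
    (\<forall>\<xi>\<in>C. boundary_act h \<xi> = boundary_act g \<xi>)"
proof -
  have sub: "Grigorchuk \<subseteq> carrier AutT" using subgroup.subset[OF Grigorchuk_subgroup] .
  have tg: "tree_automorphism g"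
    using g by (simp add: in_closure_aut_topology[OF sub] AutT_def)
  obtain m0 where m0: "inj_on (pre m0) (boundary_act g ` C)"
    using finite_separating_level \<open>finite C\<close> by blast
  define m where "m = max m0 n"
  have sep: "pre m (boundary_act g \<xi>) \<noteq> pre m (boundary_act g \<eta>)"
    if "\<xi> \<in> C" "\<eta> \<in> C" "boundary_act g \<xi> \<noteq> boundary_act g \<eta>" for \<xi> \<eta>
    using that inj_onD[OF m0] pre_antimono m_def by (metis imageI max.cobounded1)
  \<comment> \<open>Agreement is kept one level below the separating level:
    \<open>rigid_correction\<close> at depth \<open>m\<close> needs \<open>Suc m\<close> common
    letters, and grafts at depth \<open>m\<close> fix that level.\<close>
  have "\<exists>h\<in>Grigorchuk. (\<forall>w. length w = Suc m \<longrightarrow> h w = g w) \<and>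
    (\<forall>\<xi>\<in>F. boundary_act h \<xi> = boundary_act g \<xi>)" if "F \<subseteq> C" for F
    using finite_subset[OF that \<open>finite C\<close>] that
  proof (induction rule: finite_induct)
    case empty
    then show ?case using g by (simp add: in_closure_aut_topology[OF sub])
  next
    case (insert \<xi> F)
    then obtain h where h: "h \<in> Grigorchuk" "\<And>w. length w = Suc m \<Longrightarrow> h w = g w"
      "\<And>\<xi>. \<xi> \<in> F \<Longrightarrow> boundary_act h \<xi> = boundary_act g \<xi>" by auto
    obtain s where s: "s \<in> Grigorchuk" "boundary_act g \<xi> = boundary_act s \<xi>"
      using orb insert.prems by blast
    let ?\<zeta> = "boundary_act h \<xi>" and ?v = "pre m (boundary_act h \<xi>)"
    \<comment> \<open>This element takes the current image of \<open>\<xi>\<close> to the desired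
      one, so both lie in one orbit of the group.\<close>
    have sh: "boundary_act (s \<circ> finv h) ?\<zeta> = boundary_act g \<xi>"
      using h(1) s by (simp add: boundary_act_comp boundary_act_inv)
    have pre_Suc: "pre (Suc m) (boundary_act g \<xi>) = pre (Suc m) ?\<zeta>"
      by (simp only: pre_boundary_act[OF h(1)] boundary_act_prefix[OF tg])
        (simp add: h(2) del: upt_Suc)
    obtain k where k: "k \<in> branch_K" "boundary_act (graft ?v k) ?\<zeta> = boundary_act g \<xi>"
      using rigid_correction[of "s \<circ> finv h" ?\<zeta> m] s(1) h(1) pre_Suc sh by (auto simp del: upt_Suc)
    have gk: "graft ?v k \<in> Grigorchuk" by (simp add: k graft_branch_K branch_K_Grigorchuk)
    have "boundary_act (graft ?v k \<circ> h) \<eta> = boundary_act g \<eta>" if \<eta>: "\<eta> \<in> insert \<xi> F" for \<eta>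
    proof (cases "boundary_act g \<eta> = boundary_act g \<xi>")
      case True
      have "\<eta> = \<xi>"
      proof (rule pre_inject)
        fix i
        have "g (pre i \<eta>) = g (pre i \<xi>)" using True boundary_act_prefix[OF tg] by metis
        then show "pre i \<eta> = pre i \<xi>" using tg by (metis tree_automorphism_def bij_is_inj injD)
      qed
      then show ?thesis using k(2) gk h(1) by (simp add: boundary_act_comp)
    next
      case False
      let ?u = "pre m (boundary_act g \<eta>)"
      have ne: "?u \<noteq> ?v"
        using sep[of \<eta> \<xi>] False \<eta> insert.prems pre_antimono[OF pre_Suc, where m = m] by auto
      \<comment> \<open>The images of the points treated before lie outside the subtree at
        \<open>?v\<close>, so the graft leaves them in place.\<close>
      have "boundary_act (graft ?v k) (conc ?u (\<lambda>i. boundary_act g \<eta> (m + i)))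
          = conc ?u (boundary_act id (\<lambda>i. boundary_act g \<eta> (m + i)))"
        by (rule boundary_act_conc)
          (simp_all add: gk Grigorchuk_automorphism graft_outside[OF _ ne])
      then have "boundary_act (graft ?v k) (boundary_act g \<eta>) = boundary_act g \<eta>"
        by (simp add: conc_pre boundary_act_id)
      moreover have "boundary_act h \<eta> = boundary_act g \<eta>" using h(3) \<eta> False by auto
      ultimately show ?thesis using gk h(1) by (simp add: boundary_act_comp)
    qed
    moreover have "(graft ?v k \<circ> h) w = g w" if "length w = Suc m" for w
    proof -
      have "graft ?v k (h w) = h w" by (rule graft_short[OF k(1)]) (simp add: h(1) that)
      then show ?thesis by (simp only: o_apply h(2)[OF that])
    qed
    ultimately show ?case using Grigorchuk_comp[OF gk h(1)] by blast
  qed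
  from this[OF order_refl] obtain h where h: "h \<in> Grigorchuk" "\<And>w. length w = Suc m \<Longrightarrow> h w = g w"
    "\<And>\<xi>. \<xi> \<in> C \<Longrightarrow> boundary_act h \<xi> = boundary_act g \<xi>" by auto
  have "h w = g w" if "length w = n" for w
    by (rule agree_level_antimono[OF tg Grigorchuk_automorphism[OF h(1)], of n "Suc m"])
      (simp_all add: m_def h(2) that)
  then show ?thesis using h by blast
qed

theorem proposition1p14:
  fixes C :: "(nat \<Rightarrow> bool) set"
  assumes "finite C"
  shows "aut_topology closure_of Stab Grigorchuk C = Stab (aut_topology closure_of Grigorchuk) C \<and>
    ((\<exists>\<xi>. C \<subseteq> orbit (AutT\<lparr>carrier := Grigorchuk\<rparr>) boundary_act \<xi>) \<longrightarrow>
      aut_topology closure_of SStab Grigorchuk C = SStab (aut_topology closure_of Grigorchuk) C)"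
proof (intro conjI impI equalityI subsetI)
  have sub: "Grigorchuk \<subseteq> carrier AutT" using subgroup.subset[OF Grigorchuk_subgroup] .
  have Stab_sub: "Stab Grigorchuk C \<subseteq> Grigorchuk" and SStab_sub: "SStab Grigorchuk C \<subseteq> Grigorchuk"
    by (auto simp: Stab_def SStab_def)
  note Stab_cl = in_closure_aut_topology[OF subset_trans[OF Stab_sub sub]]
  note SStab_cl = in_closure_aut_topology[OF subset_trans[OF SStab_sub sub]]
  note cl = in_closure_aut_topology[OF sub]
  {
    fix g assume g: "g \<in> aut_topology closure_of Stab Grigorchuk C"
    then have tg: "tree_automorphism g" by (simp add: Stab_cl AutT_def)
    have "boundary_act g \<xi> = \<xi>" if "\<xi> \<in> C" for \<xi>
    proof (rule boundary_actI[OF tg])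
      fix n
      obtain h where h: "h \<in> Stab Grigorchuk C" "\<forall>w. length w = n \<longrightarrow> h w = g w"
        using g Stab_cl by blast
      then have "g (pre n \<xi>) = h (pre n \<xi>)" by simp
      also have "\<dots> = pre n (boundary_act h \<xi>)"
        using h(1) by (simp add: pre_boundary_act Stab_def)
      finally show "g (pre n \<xi>) = pre n \<xi>" using h(1) that by (simp add: Stab_def)
    qed
    moreover have "g \<in> aut_topology closure_of Grigorchuk"
      using closure_of_mono[OF Stab_sub] g by blast
    ultimately show "g \<in> Stab (aut_topology closure_of Grigorchuk) C" by (simp add: Stab_def)
  next
    fix g assume "g \<in> Stab (aut_topology closure_of Grigorchuk) C"
    then have g: "g \<in> aut_topology closure_of Grigorchuk" "\<And>\<xi>. \<xi> \<in> C \<Longrightarrow> boundary_act g \<xi> = \<xi>"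
      by (auto simp: Stab_def)
    have "\<exists>h\<in>Stab Grigorchuk C. \<forall>w. length w = n \<longrightarrow> h w = g w" for n
    proof -
      \<comment> \<open>Each point is its own image, so \<open>id\<close> witnesses the orbit
        condition.\<close>
      have "\<exists>s\<in>Grigorchuk. boundary_act g \<xi> = boundary_act s \<xi>" if "\<xi> \<in> C" for \<xi>
        using g(2)[OF that] by (intro bexI[of _ id]) (simp_all add: boundary_act_id)
      from approximation_on_finite_set[OF g(1) assms this, of n]
      show ?thesis using g(2) by (auto simp: Stab_def)
    qed
    then show "g \<in> aut_topology closure_of Stab Grigorchuk C" using g(1) cl Stab_cl by blast
  next
    fix g assume g: "g \<in> aut_topology closure_of SStab Grigorchuk C"
    then have tg: "tree_automorphism g" by (simp add: SStab_cl AutT_def)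
    have "boundary_act g \<xi> \<in> C" if \<xi>: "\<xi> \<in> C" for \<xi>
    proof -
      \<comment> \<open>At a level separating the image of \<open>\<xi>\<close> from the other
        points of \<open>C\<close>, sharing a prefix with an element of \<open>C\<close> forces
        equality.\<close>
      obtain n where n: "inj_on (pre n) (insert (boundary_act g \<xi>) C)"
        using finite_separating_level assms by blast
      obtain h where h: "h \<in> SStab Grigorchuk C" "\<forall>w. length w = n \<longrightarrow> h w = g w"
        using g SStab_cl by blast
      then have "pre n (boundary_act g \<xi>) = pre n (boundary_act h \<xi>)"
        by (simp add: boundary_act_prefix[OF tg] pre_boundary_act SStab_def)
      moreover have "boundary_act h \<xi> \<in> C" using h(1) \<xi> by (auto simp: SStab_def)
      ultimately show ?thesis using inj_onD[OF n] by (metis insertCI)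
    qed
    \<comment> \<open>On the finite set \<open>C\<close>, an injective self-map is onto.\<close>
    moreover have "inj_on (boundary_act g) C"
    proof (rule inj_onI, rule pre_inject)
      fix \<xi> \<eta> i assume "boundary_act g \<xi> = boundary_act g \<eta>"
      then have "g (pre i \<xi>) = g (pre i \<eta>)" using boundary_act_prefix[OF tg] by metis
      then show "pre i \<xi> = pre i \<eta>" using tg by (metis tree_automorphism_def bij_is_inj injD)
    qed
    ultimately have "boundary_act g ` C = C" using assms by (intro endo_inj_surj) auto
    moreover have "g \<in> aut_topology closure_of Grigorchuk"
      using closure_of_mono[OF SStab_sub] g by blast
    ultimately show "g \<in> SStab (aut_topology closure_of Grigorchuk) C" by (simp add: SStab_def)
  next
    fix g assume orb: "\<exists>\<xi>. C \<subseteq> orbit (AutT\<lparr>carrier := Grigorchuk\<rparr>) boundary_act \<xi>"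
      and "g \<in> SStab (aut_topology closure_of Grigorchuk) C"
    then have g: "g \<in> aut_topology closure_of Grigorchuk" "boundary_act g ` C = C"
      by (auto simp: SStab_def)
    obtain \<xi>0 where \<xi>0: "\<And>\<xi>. \<xi> \<in> C \<Longrightarrow> \<exists>s\<in>Grigorchuk. \<xi> = boundary_act s \<xi>0"
      using orb by (fastforce simp: orbit_def)
    have same: "\<exists>s\<in>Grigorchuk. boundary_act g \<xi> = boundary_act s \<xi>" if \<xi>: "\<xi> \<in> C" for \<xi>
    proof -
      obtain s where s: "s \<in> Grigorchuk" "\<xi> = boundary_act s \<xi>0" using \<xi>0[OF \<xi>] by blast
      obtain t where t: "t \<in> Grigorchuk" "boundary_act g \<xi> = boundary_act t \<xi>0"
        using \<xi>0[of "boundary_act g \<xi>"] \<xi> g(2) by blast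
      \<comment> \<open>Go back from \<open>\<xi>\<close> to the common base point by the inverse of
        \<open>s\<close>, then on to the image by \<open>t\<close>.\<close>
      have "boundary_act g \<xi> = boundary_act (t \<circ> finv s) \<xi>"
        unfolding t(2) using s t(1) by (simp add: boundary_act_comp boundary_act_inv)
      then show ?thesis using Grigorchuk_comp[OF t(1) Grigorchuk_inv[OF s(1)]] by blast
    qed
    have "\<exists>h\<in>SStab Grigorchuk C. \<forall>w. length w = n \<longrightarrow> h w = g w" for n
    proof -
      obtain h where h: "h \<in> Grigorchuk" "\<forall>w. length w = n \<longrightarrow> h w = g w"
        "\<forall>\<xi>\<in>C. boundary_act h \<xi> = boundary_act g \<xi>"
        using approximation_on_finite_set[OF g(1) assms same] by blast
      then have "boundary_act h ` C = C" using g(2) by (metis image_cong)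
      then show ?thesis using h by (intro bexI[of _ h]) (simp_all add: SStab_def)
    qed
    then show "g \<in> aut_topology closure_of SStab Grigorchuk C" using g(1) cl SStab_cl by blast
  }
qed

end
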